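(* Let $G$ be a finite simple graph that is $(P_4 \cup P_2)$-free, and let $\omega = \omega(G)$ be its clique number. Then $\chi(G) \leq \frac{\omega(\omega+1)(\omega+2)}{6}$.
   Context: A graph $G$ is $H$-free if $G$ contains no induced subgraph isomorphic to $H$. $P_n$ denotes the path on $n$ vertices, and $P_4 \cup P_2$ denotes the disjoint union of a path on 4 vertices and a path on 2 vertices (with no edges between them). $\chi(G)$ is the chromatic number and $\omega(G)$ the clique number of $G$. *)

theory Defs
  imports Complex_Main "Graph_Theory.Graph_Theory"
begin

text \<open>
  Finite simple graphs are the symmetric digraphs of locale \<^locale>\<open>graph\<close>: finite, loopfree and
  without parallel arcs, each undirected edge being a pair of opposite arcs.
\<close>

definition path_graph :: "nat \<Rightarrow> nat pair_pre_digraph" where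
  "path_graph n =
    \<lparr> pverts = {..<n}, parcs = {(i, j). i < n \<and> j < n \<and> (j = Suc i \<or> i = Suc j)} \<rparr>"

definition disjoint_union ::
    "'a pair_pre_digraph \<Rightarrow> 'b pair_pre_digraph \<Rightarrow> ('a + 'b) pair_pre_digraph" where
  "disjoint_union G H =
    \<lparr> pverts = pverts G <+> pverts H,
      parcs = map_prod Inl Inl ` parcs G \<union> map_prod Inr Inr ` parcs H \<rparr>"

definition induced_free :: "('c, 'd) pre_digraph \<Rightarrow> ('a, 'b) pre_digraph \<Rightarrow> bool" where
  "induced_free H G \<longleftrightarrow> \<not> (\<exists>K. induced_subgraph K G \<and> digraph_iso K H)"

definition clique :: "('a, 'b) pre_digraph \<Rightarrow> 'a set \<Rightarrow> bool" where
  "clique G S \<longleftrightarrow> S \<subseteq> verts G \<and> (\<forall>u\<in>S. \<forall>v\<in>S. u \<noteq> v \<longrightarrow> u \<rightarrow>\<^bsub>G\<^esub> v)"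

definition clique_number :: "('a, 'b) pre_digraph \<Rightarrow> nat" where
  "clique_number G = Max (card ` {S. clique G S})"

definition proper_colouring :: "('a, 'b) pre_digraph \<Rightarrow> nat \<Rightarrow> ('a \<Rightarrow> nat) \<Rightarrow> bool" where
  "proper_colouring G k c \<longleftrightarrow>
    c ` verts G \<subseteq> {..<k} \<and> (\<forall>u\<in>verts G. \<forall>v\<in>verts G. u \<rightarrow>\<^bsub>G\<^esub> v \<longrightarrow> c u \<noteq> c v)"

definition chromatic_number :: "('a, 'b) pre_digraph \<Rightarrow> nat" where
  "chromatic_number G = (LEAST k. \<exists>c. proper_colouring G k c)"

lemma pair_graph_path_graph: "pair_graph (path_graph n)"
proof -
  have "parcs (path_graph n) \<subseteq> {..<n} \<times> {..<n}"
    by (auto simp: path_graph_def)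
  then have "finite (parcs (path_graph n))"
    by (rule finite_subset) simp
  then show ?thesis
    by unfold_locales (auto simp: path_graph_def symmetric_def intro!: symI)
qed

lemma pair_graph_disjoint_union:
  assumes "pair_graph G" "pair_graph H"
  shows "pair_graph (disjoint_union G H)"
proof -
  interpret G: pair_graph G by fact
  interpret H: pair_graph H by fact
  have "sym (parcs G)" "sym (parcs H)"
    using G.sym_arcs H.sym_arcs by (simp_all add: symmetric_def)
  then have "sym (parcs (disjoint_union G H))"
    by (auto simp: disjoint_union_def sym_def)
  then have "symmetric (with_proj (disjoint_union G H))"
    by (simp add: symmetric_def)
  moreover have "finite (pverts (disjoint_union G H))" "finite (parcs (disjoint_union G H))"
    using G.pair_finite_verts H.pair_finite_verts G.pair_finite_arcs H.pair_finite_arcs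
    by (simp_all add: disjoint_union_def)
  moreover have "fst e \<in> pverts (disjoint_union G H) \<and> snd e \<in> pverts (disjoint_union G H)
      \<and> fst e \<noteq> snd e" if e: "e \<in> parcs (disjoint_union G H)" for e
  proof -
    from e consider (l) u v where "(u, v) \<in> parcs G" "e = (Inl u, Inl v)"
      | (r) u v where "(u, v) \<in> parcs H" "e = (Inr u, Inr v)"
      by (auto simp: disjoint_union_def)
    then show ?thesis
    proof cases
      case l
      then show ?thesis
        using G.in_arcsD1[OF l(1)] G.in_arcsD2[OF l(1)] G.pair_no_loops[OF l(1)]
        by (simp add: disjoint_union_def InlI)
    next
      case r
      then show ?thesis
        using H.in_arcsD1[OF r(1)] H.in_arcsD2[OF r(1)] H.pair_no_loops[OF r(1)]
        by (simp add: disjoint_union_def InrI)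
    qed
  qed
  ultimately show ?thesis by unfold_locales blast+
qed

lemma clique_number_attained:
  assumes "graph G"
  shows "\<exists>S. clique G S \<and> card S = clique_number G"
    and "clique G S \<Longrightarrow> card S \<le> clique_number G"
proof -
  interpret graph G by fact
  have fin: "finite (card ` {S. clique G S})"
    by (rule finite_imageI, rule finite_subset[of _ "Pow (verts G)"]) (auto simp: clique_def)
  have "clique G {}" by (simp add: clique_def)
  then have "card ` {S. clique G S} \<noteq> {}" by auto
  from Max_in[OF fin this] show "\<exists>S. clique G S \<and> card S = clique_number G"
    unfolding clique_number_def by auto
  show "card S \<le> clique_number G" if "clique G S"
    using fin that unfolding clique_number_def by (intro Max_ge) auto
qed

lemma chromatic_number_attained:
  assumes "graph G"
  shows "\<exists>c. proper_colouring G (chromatic_number G) c"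
proof -
  interpret graph G by fact
  obtain c where c: "bij_betw c (verts G) {0..<card (verts G)}"
    using ex_bij_betw_finite_nat finite_verts by blast
  have "c u \<noteq> c v" if "u \<in> verts G" "v \<in> verts G" "u \<rightarrow>\<^bsub>G\<^esub> v" for u v
  proof -
    have "u \<noteq> v" using that(3) adj_not_same by blast
    then show ?thesis
      using inj_onD[OF bij_betw_imp_inj_on[OF c] _ that(1,2)] by blast
  qed
  moreover have "c ` verts G \<subseteq> {..<card (verts G)}"
    using c by (simp add: bij_betw_def lessThan_atLeast0)
  ultimately have "proper_colouring G (card (verts G)) c"
    unfolding proper_colouring_def by blast
  then have "\<exists>k c. proper_colouring G k c" by blast
  then show ?thesis
    unfolding chromatic_number_def by (rule LeastI_ex)
qed

lemma chromatic_number_le: "proper_colouring G k c \<Longrightarrow> chromatic_number G \<le> k"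
  unfolding chromatic_number_def by (rule Least_le) blast

lemma not_induced_free_iff:
  assumes G: "graph G" and H: "pair_graph H"
  shows "\<not> induced_free (with_proj H) G \<longleftrightarrow>
    (\<exists>f. inj_on f (pverts H) \<and> f ` pverts H \<subseteq> verts G \<and>
      (\<forall>u\<in>pverts H. \<forall>v\<in>pverts H. (u, v) \<in> parcs H \<longleftrightarrow> f u \<rightarrow>\<^bsub>G\<^esub> f v))"
    (is "?L \<longleftrightarrow> ?R")
proof
  interpret G: graph G by fact
  interpret H: pair_graph H by fact
  {
    assume ?L
    then obtain K h where K: "induced_subgraph K G"
      and h: "pre_digraph.digraph_isomorphism K h" and HK: "with_proj H = app_iso h K"
      unfolding induced_free_def digraph_iso_def by blast
    have inj: "inj_on (iso_verts h) (verts K)"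
      and ends: "\<And>a. a \<in> arcs K \<Longrightarrow> iso_verts h (tail K a) = iso_tail h (iso_arcs h a) \<and>
        iso_verts h (head K a) = iso_head h (iso_arcs h a)"
      using h by (auto simp: pre_digraph.digraph_isomorphism_def)
    have pv: "pverts H = iso_verts h ` verts K" and pa: "parcs H = iso_arcs h ` arcs K"
      and tl: "iso_tail h = fst" and hd: "iso_head h = snd"
      using arg_cong[OF HK, of verts] arg_cong[OF HK, of arcs]
        arg_cong[OF HK, of tail] arg_cong[OF HK, of head] by simp_all
    have sub: "verts K \<subseteq> verts G" and th: "tail K = tail G" "head K = head G"
      and aK: "arcs K = {e \<in> arcs G. tail G e \<in> verts K \<and> head G e \<in> verts K}"
      using K by (auto simp: induced_subgraph_def subgraph_def compatible_def)
    define f where "f = the_inv_into (verts K) (iso_verts h)"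
    have bij: "bij_betw f (pverts H) (verts K)"
      unfolding f_def pv by (rule bij_betw_the_inv_into) (simp add: bij_betw_def inj)
    have fv: "f (iso_verts h x) = x" if "x \<in> verts K" for x
      unfolding f_def using inj that by (rule the_inv_into_f_f)
    have vf: "iso_verts h (f u) = u" if "u \<in> pverts H" for u
      using that fv unfolding pv by auto
    have arc: "iso_arcs h e = (iso_verts h (tail G e), iso_verts h (head G e))" if "e \<in> arcs K" for e
      using ends[OF that] by (simp add: tl hd th prod_eq_iff)
    have arcs: "(u, v) \<in> parcs H \<longleftrightarrow> f u \<rightarrow>\<^bsub>G\<^esub> f v" if u: "u \<in> pverts H" and v: "v \<in> pverts H" for u v
    proof
      assume "(u, v) \<in> parcs H"
      then obtain e where e: "e \<in> arcs K" "(u, v) = iso_arcs h e" unfolding pa by auto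
      then have "u = iso_verts h (tail G e)" "v = iso_verts h (head G e)" using arc by auto
      then have "f u = tail G e" "f v = head G e" using e aK fv by auto
      then show "f u \<rightarrow>\<^bsub>G\<^esub> f v" using e aK by (auto simp: arcs_ends_def arc_to_ends_def)
    next
      assume "f u \<rightarrow>\<^bsub>G\<^esub> f v"
      then obtain e where e: "e \<in> arcs G" "tail G e = f u" "head G e = f v"
        by (auto simp: arcs_ends_def arc_to_ends_def)
      then have eK: "e \<in> arcs K" using bij u v aK by (auto simp: bij_betw_def)
      then show "(u, v) \<in> parcs H" unfolding pa using arc[OF eK] e vf u v
        by (metis image_eqI)
    qed
    have "inj_on f (pverts H)" "f ` pverts H \<subseteq> verts G"
      using bij sub by (auto simp: bij_betw_def)
    then show ?R using arcs by (intro exI[of _ f] conjI ballI) simp_all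
  next
    assume ?R
    then obtain f where inj: "inj_on f (pverts H)" and sub: "f ` pverts H \<subseteq> verts G"
      and arc: "\<And>u v. u \<in> pverts H \<Longrightarrow> v \<in> pverts H \<Longrightarrow> (u, v) \<in> parcs H \<longleftrightarrow> f u \<rightarrow>\<^bsub>G\<^esub> f v"
      by blast
    define g where "g = the_inv_into (pverts H) f"
    have gf: "g (f u) = u" if "u \<in> pverts H" for u
      unfolding g_def using inj that by (rule the_inv_into_f_f)
    define K where "K = G \<restriction> (f ` pverts H)"
    define h where "h = \<lparr> iso_verts = g, iso_arcs = (\<lambda>e. (g (tail G e), g (head G e))),
      iso_head = snd, iso_tail = fst \<rparr>"
    have K: "induced_subgraph K G"
      unfolding K_def by (rule G.induced_induce[OF sub])
    have aK: "arcs K = {e \<in> arcs G. tail G e \<in> f ` pverts H \<and> head G e \<in> f ` pverts H}"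
      and vK: "verts K = f ` pverts H" and tK: "tail K = tail G" and hK: "head K = head G"
      by (simp_all add: K_def)
    have injg: "inj_on g (f ` pverts H)" by (auto simp: inj_on_def gf)
    have "inj_on (\<lambda>e. (g (tail G e), g (head G e))) (arcs K)"
    proof (rule inj_onI)
      fix e e' assume "e \<in> arcs K" "e' \<in> arcs K"
        and "(g (tail G e), g (head G e)) = (g (tail G e'), g (head G e'))"
      then have "tail G e = tail G e'" "head G e = head G e'" "e \<in> arcs G" "e' \<in> arcs G"
        using injg by (auto simp: aK dest: inj_onD)
      then show "e = e'" using G.no_multi_arcs by (auto simp: arc_to_ends_def)
    qed
    moreover have "wf_digraph K" using K by (auto simp: induced_subgraph_def subgraph_def)
    ultimately have "pre_digraph.digraph_isomorphism K h"
      by (auto simp: pre_digraph.digraph_isomorphism_def h_def vK tK hK injg)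
    moreover have "(\<lambda>e. (g (tail G e), g (head G e))) ` arcs K = parcs H"
    proof (intro equalityI subsetI)
      fix p assume "p \<in> (\<lambda>e. (g (tail G e), g (head G e))) ` arcs K"
      then obtain e u v where e: "e \<in> arcs G" "u \<in> pverts H" "v \<in> pverts H"
        "tail G e = f u" "head G e = f v" "p = (g (f u), g (f v))"
        by (auto simp: aK)
      then have "f u \<rightarrow>\<^bsub>G\<^esub> f v" by (metis G.in_arcs_imp_in_arcs_ends)
      then show "p \<in> parcs H" using arc e gf by auto
    next
      fix p assume p: "p \<in> parcs H"
      obtain u v where uv: "p = (u, v)" by (cases p)
      then have V: "u \<in> pverts H" "v \<in> pverts H"
        using p H.in_arcsD1 H.in_arcsD2 by auto
      then have "f u \<rightarrow>\<^bsub>G\<^esub> f v" using arc p uv by auto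
      then obtain e where "e \<in> arcs G" "tail G e = f u" "head G e = f v"
        by (auto simp: arcs_ends_def arc_to_ends_def)
      then show "p \<in> (\<lambda>e. (g (tail G e), g (head G e))) ` arcs K"
        using V uv gf by (intro image_eqI[of _ _ e]) (auto simp: aK)
    qed
    moreover have "g ` f ` pverts H = pverts H" using gf by force
    ultimately have "digraph_iso K (with_proj H)"
      unfolding digraph_iso_def
      by (intro exI[of _ h]) (simp add: app_iso_def h_def vK with_proj_def)
    then show ?L using K by (auto simp: induced_free_def)
  }
qed

end

theory Submission
  imports Defs
begin

text \<open>
  Enumerate a maximum clique as \<open>k 0, \<dots>, k (\<omega> - 1)\<close> and sort the vertices by the first two clique
  vertices they miss. The vertices missing only \<open>k i\<close> are independent. Those whose first two missed
  clique vertices are \<open>k i\<close> and \<open>k j\<close>, \<open>i < j\<close>, are anticomplete to an edge, hence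
  induce a \<open>P\<^sub>4\<close>-free graph, and they are complete to \<open>j - 1\<close> clique vertices, hence have
  clique number at most \<open>\<omega> + 1 - j\<close>; as \<open>P\<^sub>4\<close>-free graphs are perfect, that many colours suffice.
  Summing up gives \<open>\<omega> + (\<Sum>j = 1..<\<omega>. j * (\<omega> + 1 - j))\<close> colours.
\<close>

section \<open>Colourings of a vertex set\<close>

text \<open>Stated for a relation and a vertex set, so that pieces of the vertex set can be coloured
  without forming induced subgraphs.\<close>

definition colourable :: "('a \<Rightarrow> 'a \<Rightarrow> bool) \<Rightarrow> 'a set \<Rightarrow> nat \<Rightarrow> bool" where
  "colourable E V n \<longleftrightarrow> (\<exists>c. c ` V \<subseteq> {..<n} \<and> (\<forall>u\<in>V. \<forall>v\<in>V. E u v \<longrightarrow> c u \<noteq> c v))"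

lemma colourable_Un:
  assumes "colourable E A m" "colourable E B n"
  shows "colourable E (A \<union> B) (m + n)"
proof -
  obtain a where a: "a ` A \<subseteq> {..<m}" "\<forall>u\<in>A. \<forall>v\<in>A. E u v \<longrightarrow> a u \<noteq> a v"
    using assms(1) unfolding colourable_def by blast
  obtain b where b: "b ` B \<subseteq> {..<n}" "\<forall>u\<in>B. \<forall>v\<in>B. E u v \<longrightarrow> b u \<noteq> b v"
    using assms(2) unfolding colourable_def by blast
  \<comment> \<open>\<open>B\<close> gets a palette shifted past that of \<open>A\<close>; on the
    overlap the colour from \<open>A\<close> wins.\<close>
  define c where "c x = (if x \<in> A then a x else m + b x)" for x
  have "a x < m" if "x \<in> A" for x
    using a(1) that by auto
  moreover have "b x < n" if "x \<in> B" for x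
    using b(1) that by auto
  ultimately have "c ` (A \<union> B) \<subseteq> {..<m + n}"
    by (auto simp: c_def trans_less_add1)
  moreover have "c u \<noteq> c v" if "u \<in> A \<union> B" "v \<in> A \<union> B" "E u v" for u v
    using that a(2) b(2) \<open>\<And>x. x \<in> A \<Longrightarrow> a x < m\<close>[of u] \<open>\<And>x. x \<in> A \<Longrightarrow> a x < m\<close>[of v]
    by (auto simp: c_def)
  ultimately show ?thesis
    unfolding colourable_def by blast
qed

lemma colourable_UN:
  assumes "finite T" "\<And>t. t \<in> T \<Longrightarrow> colourable E (A t) (n t)"
  shows "colourable E (\<Union>t\<in>T. A t) (\<Sum>t\<in>T. n t)"
  using assms
proof (induction T rule: finite_induct)
  case empty
  then show ?case by (simp add: colourable_def)
next
  case (insert t T)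
  then show ?case using colourable_Un[of E "A t" "n t"] by simp
qed

lemma colourable_subset: "colourable E B n \<Longrightarrow> A \<subseteq> B \<Longrightarrow> colourable E A n"
  unfolding colourable_def by (meson image_mono subset_iff subset_trans)

section \<open>Greedy colourings and P4-free graphs\<close>

text \<open>Each inserted vertex gets the least colour absent from its neighbours, so it sees every
  smaller colour; later insertions leave earlier colours unchanged.\<close>

lemma greedy_colouring:
  fixes E :: "'a \<Rightarrow> 'a \<Rightarrow> bool"
  assumes "finite V" and sym: "\<And>u v. E u v \<Longrightarrow> E v u" and irrefl: "\<And>u. \<not> E u u"
  shows "\<exists>c::'a \<Rightarrow> nat. (\<forall>u\<in>V. \<forall>v\<in>V. E u v \<longrightarrow> c u \<noteq> c v) \<and>
    (\<forall>v\<in>V. \<forall>i<c v. \<exists>u\<in>V. E v u \<and> c u = i)"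
  using \<open>finite V\<close>
proof (induction V rule: finite_induct)
  case empty
  then show ?case by simp
next
  case (insert x V)
  then obtain c :: "'a \<Rightarrow> nat" where c: "\<And>u v. u \<in> V \<Longrightarrow> v \<in> V \<Longrightarrow> E u v \<Longrightarrow> c u \<noteq> c v"
    and gr: "\<And>v i. v \<in> V \<Longrightarrow> i < c v \<Longrightarrow> \<exists>u\<in>V. E v u \<and> c u = i"
    by blast
  define m where "m = (LEAST i. \<forall>u\<in>V. E x u \<longrightarrow> c u \<noteq> i)"
  obtain j where "j \<notin> c ` V"
    using insert(1) ex_new_if_finite infinite_UNIV_nat by blast
  then have "\<forall>u\<in>V. E x u \<longrightarrow> c u \<noteq> j"
    by blast
  then have m: "\<forall>u\<in>V. E x u \<longrightarrow> c u \<noteq> m"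
    unfolding m_def by (rule LeastI)
  have below_m: "\<exists>u\<in>V. E x u \<and> c u = i" if "i < m" for i
    using not_less_Least[OF that[unfolded m_def]] by blast
  define c' where "c' = c(x := m)"
  have c': "c' u = c u" if "u \<in> V" for u
    using that insert(2) by (auto simp: c'_def)
  have c'x: "c' x = m"
    by (simp add: c'_def)
  have "c' u \<noteq> c' v" if uv: "u \<in> insert x V" "v \<in> insert x V" "E u v" for u v
  proof -
    consider "u \<in> V" "v \<in> V" | "u = x" "v \<in> V" | "v = x" "u \<in> V" | "u = x" "v = x"
      using uv by blast
    then show ?thesis
      by cases (use c c' c'x m uv irrefl sym in \<open>metis+\<close>)
  qed
  moreover have "\<exists>u\<in>insert x V. E v u \<and> c' u = i" if "v \<in> insert x V" "i < c' v" for v i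
    using that gr below_m c' c'x by (metis insert_iff)
  ultimately show ?case by blast
qed

text \<open>
  The greedy colouring is optimal: the top colour can be completed to a clique meeting all colours
  below it, one colour at a time.
\<close>
lemma P4_free_colourable:
  fixes E :: "'a \<Rightarrow> 'a \<Rightarrow> bool"
  assumes fin: "finite V" and sym: "\<And>u v. E u v \<Longrightarrow> E v u" and irrefl: "\<And>u. \<not> E u u"
    and P4: "\<And>a b c d. {a, b, c, d} \<subseteq> V \<Longrightarrow> E a b \<Longrightarrow> E b c \<Longrightarrow> E c d \<Longrightarrow>
      E a c \<or> E a d \<or> E b d"
    and bound: "\<And>S. S \<subseteq> V \<Longrightarrow> pairwise E S \<Longrightarrow> card S \<le> n"
  shows "colourable E V n"
proof -
  obtain c :: "'a \<Rightarrow> nat" where c: "\<And>u v. u \<in> V \<Longrightarrow> v \<in> V \<Longrightarrow> E u v \<Longrightarrow> c u \<noteq> c v"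
    and gr: "\<And>v i. v \<in> V \<Longrightarrow> i < c v \<Longrightarrow> \<exists>u\<in>V. E v u \<and> c u = i"
    using greedy_colouring[of V E, OF fin sym irrefl] by blast
  have "c v < n" if v: "v \<in> V" for v
  proof -
    \<comment> \<open>Descending induction grows a clique from \<open>{v}\<close> meeting exactly
      the colours \<open>i\<close> to \<open>c v\<close>; at \<open>i = 0\<close> it has at least
      \<open>c v + 1\<close> vertices.\<close>
    have "\<exists>Q\<subseteq>V. pairwise E Q \<and> c ` Q = {i..c v}" if "i \<le> c v" for i
      using that
    proof (induction i rule: inc_induct)
      case base
      then show ?case using v by (intro exI[of _ "{v}"]) simp
    next
      case (step i)
      then obtain Q where Q: "Q \<subseteq> V" "pairwise E Q" "c ` Q = {Suc i..c v}"
        by blast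
      have nb: "\<exists>u\<in>V. E z u \<and> c u = i" if "z \<in> Q" for z
      proof -
        have "c z \<in> {Suc i..c v}"
          using that Q(3) by blast
        then show ?thesis
          using gr[of z i] that Q(1) by auto
      qed
      define X where "X = {x \<in> V. c x = i}"
      define d where "d x = card {z \<in> Q. E x z}" for x
      have finQ: "finite Q"
        using Q fin finite_subset by blast
      have "X \<noteq> {}" "finite X"
        using gr[OF v step.hyps(2)] fin unfolding X_def by auto
      \<comment> \<open>The new clique vertex is one of colour \<open>i\<close> with the most
        neighbours in \<open>Q\<close>; maximality will make it adjacent to all of
        \<open>Q\<close>.\<close>
      then obtain x where x: "x \<in> X" and x_max: "\<And>y. y \<in> X \<Longrightarrow> d y \<le> d x"
        using Max_in[of "d ` X"] Max_ge[of "d ` X"] by (metis (no_types, lifting) finite_imageI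
          image_iff image_is_empty)
      have "E x z" if z: "z \<in> Q" for z
      proof (rule ccontr)
        assume xz: "\<not> E x z"
        obtain y where y: "y \<in> X" "E z y"
          using nb[OF z] unfolding X_def by blast
        \<comment> \<open>Since \<open>y\<close> sees \<open>z\<close> and \<open>x\<close> does
          not, maximality yields \<open>w\<close> in \<open>Q\<close> seen by \<open>x\<close> but
          not by \<open>y\<close>. As \<open>x\<close> and \<open>y\<close> share a colour,
          \<open>x\<close>, \<open>w\<close>, \<open>z\<close>, \<open>y\<close> is an induced
          P4.\<close>
        have "\<not> {w \<in> Q. E x w} \<subset> {w \<in> Q. E y w}"
          using psubset_card_mono[of "{w \<in> Q. E y w}" "{w \<in> Q. E x w}"] finQ x_max[OF y(1)]
          unfolding d_def by force
        then obtain w where w: "w \<in> Q" "E x w" "\<not> E y w"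
          using y(2) z xz sym by blast
        have "E w z"
          using Q(2) w z xz unfolding pairwise_def by metis
        moreover have "\<not> E x y"
          using x y(1) c unfolding X_def by fastforce
        ultimately show False
          using P4[of x w z y] w z y xz x Q(1) sym unfolding X_def by blast
      qed
      then have "pairwise E (insert x Q)"
        using Q(2) sym unfolding pairwise_insert by blast
      moreover have "c ` insert x Q = {i..c v}"
        using x Q(3) step.hyps unfolding X_def by auto
      moreover have "insert x Q \<subseteq> V"
        using x Q(1) unfolding X_def by blast
      ultimately show ?case by blast
    qed
    from this[of 0] obtain Q where Q: "Q \<subseteq> V" "pairwise E Q" "c ` Q = {0..c v}"
      by auto
    have "Suc (c v) \<le> card Q"
      using card_image_le[of Q c] Q(3) finite_subset[OF Q(1) fin] by simp
    then show ?thesis using bound[OF Q(1,2)] by simp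
  qed
  then have "c ` V \<subseteq> {..<n}" by auto
  then show ?thesis unfolding colourable_def using c by blast
qed

section \<open>Sorting the vertices by the clique vertices they miss\<close>

text \<open>Distinctness is implicit in \<open>free\<close>: a coincidence either contradicts
  irreflexivity or forces one of the listed adjacencies. The factor \<open>j\<close> counts the
  \<open>i < j\<close>.\<close>

lemma P4_P2_free_colourable:
  fixes E :: "'a \<Rightarrow> 'a \<Rightarrow> bool"
  assumes fin: "finite V" and sym: "\<And>u v. E u v \<Longrightarrow> E v u" and irrefl: "\<And>u. \<not> E u u"
    and free: "\<And>a b c d p q. {a, b, c, d, p, q} \<subseteq> V \<Longrightarrow> E a b \<Longrightarrow> E b c \<Longrightarrow> E c d \<Longrightarrow> E p q \<Longrightarrow>
      E a c \<or> E a d \<or> E b d \<or> (\<exists>x\<in>{a, b, c, d}. E x p \<or> E x q)"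
    and K: "K \<subseteq> V" "pairwise E K" "card K = w"
    and bound: "\<And>S. S \<subseteq> V \<Longrightarrow> pairwise E S \<Longrightarrow> card S \<le> w"
  shows "colourable E V (w + (\<Sum>j = 1..<w. j * (w + 1 - j)))"
proof -
  have finK: "finite K"
    using K(1) fin finite_subset by blast
  obtain k where "bij_betw k {0..<w} K"
    using ex_bij_betw_nat_finite[OF finK] K(3) by blast
  then have k: "inj_on k {..<w}" "k ` {..<w} = K"
    by (auto simp: bij_betw_def lessThan_atLeast0)
  have kV: "k i \<in> V" if "i < w" for i
    using that k K(1) by blast
  have kk: "E (k i) (k j)" if "i < w" "j < w" "i \<noteq> j" for i j
  proof -
    have "k i \<noteq> k j"
      using that k(1) by (auto dest: inj_onD)
    then show ?thesis
      using that k(2) K(2) unfolding pairwise_def by blast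
  qed
  \<comment> \<open>The clique vertex \<open>k i\<close> itself lies in \<open>D i\<close>, so the
    classes cover the clique too.\<close>
  define D where "D i = {v \<in> V. \<not> E v (k i) \<and> (\<forall>l<w. l \<noteq> i \<longrightarrow> E v (k l))}" for i
  define C where
    "C i j = {v \<in> V. \<not> E v (k i) \<and> \<not> E v (k j) \<and> (\<forall>l<j. l \<noteq> i \<longrightarrow> E v (k l))}" for i j
  \<comment> \<open>Irreflexivity keeps \<open>S\<close> disjoint from the clique vertices it is
    complete to, so the union is a clique of this size.\<close>
  have extend: "card S + card J \<le> w"
    if S: "S \<subseteq> V" "pairwise E S" and J: "J \<subseteq> {..<w}"
      and SJ: "\<And>v l. v \<in> S \<Longrightarrow> l \<in> J \<Longrightarrow> E v (k l)" for S J
  proof -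
    have "S \<inter> k ` J = {}"
      using SJ irrefl by blast
    then have "card (S \<union> k ` J) = card S + card (k ` J)"
      using S(1) J fin by (intro card_Un_disjoint) (auto intro: finite_subset)
    moreover have "card (k ` J) = card J"
      by (rule card_image) (rule inj_on_subset[OF k(1) J])
    moreover have "pairwise E (S \<union> k ` J)"
      unfolding pairwise_def
    proof (intro ballI impI)
      fix x y assume "x \<in> S \<union> k ` J" "y \<in> S \<union> k ` J" "x \<noteq> y"
      then show "E x y"
        using S(2) SJ kk J sym unfolding pairwise_def
        by (elim UnE imageE) (simp, blast, blast, metis lessThan_iff subsetD)
    qed
    moreover have "S \<union> k ` J \<subseteq> V"
      using S(1) J kV by blast
    ultimately show ?thesis
      using bound by metis
  qed
  have D: "colourable E (D i) 1" if i: "i < w" for i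
  proof -
    have "\<not> E u v" if "u \<in> D i" "v \<in> D i" for u v
    proof
      assume uv: "E u v"
      have "u \<noteq> v"
        using uv irrefl by blast
      \<comment> \<open>An edge inside \<open>D i\<close> could replace \<open>k i\<close> in the
        clique, giving \<open>w + 1\<close> vertices.\<close>
      moreover have "card {u, v} + card ({..<w} - {i}) \<le> w"
        using that uv sym by (intro extend) (auto simp: D_def pairwise_def)
      ultimately show False
        using i by simp
    qed
    then show ?thesis
      unfolding colourable_def by (intro exI[of _ "\<lambda>_. 0"]) auto
  qed
  have C: "colourable E (C i j) (w + 1 - j)" if ij: "i < j" "j < w" for i j
  proof (rule P4_free_colourable)
    show "finite (C i j)"
      using fin by (simp add: C_def)
    fix a b c d
    assume abcd: "{a, b, c, d} \<subseteq> C i j" and "E a b" "E b c" "E c d"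
    \<comment> \<open>The edge from \<open>k i\<close> to \<open>k j\<close> serves as the P2: no
      vertex of \<open>C i j\<close> sees either end.\<close>
    have "{a, b, c, d, k i, k j} \<subseteq> V"
      using abcd kV ij unfolding C_def by auto
    from free[OF this \<open>E a b\<close> \<open>E b c\<close> \<open>E c d\<close>] show "E a c \<or> E a d \<or> E b d"
      using abcd kk[of i j] ij unfolding C_def by auto
  next
    fix S
    assume S: "S \<subseteq> C i j" "pairwise E S"
    \<comment> \<open>As \<open>i < j\<close>, the set \<open>{..<j} - {i}\<close> has
      \<open>j - 1\<close> elements, whence the bound \<open>w - (j - 1)\<close>.\<close>
    have "card S + card ({..<j} - {i}) \<le> w"
      using S ij by (intro extend) (auto simp: C_def)
    then show "card S \<le> w + 1 - j"
      using ij by simp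
  qed (use sym irrefl in blast)+
  have cover: "V \<subseteq> (\<Union>i<w. D i) \<union> (\<Union>j\<in>{1..<w}. \<Union>i<j. C i j)"
  proof
    fix v assume v: "v \<in> V"
    \<comment> \<open>Otherwise \<open>v\<close> would enlarge the maximum clique.\<close>
    have "\<exists>i<w. \<not> E v (k i)"
    proof (rule ccontr)
      assume "\<not> ?thesis"
      then have "card {v} + card {..<w} \<le> w"
        using v by (intro extend) auto
      then show False by simp
    qed
    then obtain i where i: "i < w" "\<not> E v (k i)" "\<And>l. l < i \<Longrightarrow> E v (k l)"
      using exists_least_iff[of "\<lambda>i. i < w \<and> \<not> E v (k i)"] by (metis order.strict_trans)
    show "v \<in> (\<Union>i<w. D i) \<union> (\<Union>j\<in>{1..<w}. \<Union>i<j. C i j)"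
    proof (cases "v \<in> D i")
      case True
      then show ?thesis using i by blast
    next
      case False
      then have "\<exists>j<w. j \<noteq> i \<and> \<not> E v (k j)"
        using v i unfolding D_def by blast
      then obtain j where j: "j < w" "j \<noteq> i" "\<not> E v (k j)"
        "\<And>l. l < j \<Longrightarrow> l \<noteq> i \<Longrightarrow> E v (k l)"
        using exists_least_iff[of "\<lambda>j. j < w \<and> j \<noteq> i \<and> \<not> E v (k j)"]
        by (metis order.strict_trans)
      have "i < j"
        using i(3) j(2,3) by (metis linorder_neqE_nat)
      moreover have "v \<in> C i j"
        using v i j unfolding C_def by blast
      ultimately show ?thesis
        using j(1) by force
    qed
  qed
  have "colourable E (\<Union>i<w. D i) (\<Sum>i<w. 1)"
    using D by (intro colourable_UN) auto
  \<comment> \<open>With \<open>j\<close> as outer index the inner sum is constant and collapses to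
    a product.\<close>
  moreover have "colourable E (\<Union>j\<in>{1..<w}. \<Union>i<j. C i j) (\<Sum>j = 1..<w. \<Sum>i<j. w + 1 - j)"
    using C by (intro colourable_UN) auto
  ultimately have "colourable E ((\<Union>i<w. D i) \<union> (\<Union>j\<in>{1..<w}. \<Union>i<j. C i j))
      ((\<Sum>i<w. 1) + (\<Sum>j = 1..<w. \<Sum>i<j. w + 1 - j))"
    by (rule colourable_Un)
  then show ?thesis
    using colourable_subset[OF _ cover] by simp
qed

section \<open>Evaluating the number of colours\<close>

text \<open>\<open>a\<close> is kept apart from \<open>n\<close> because the intended value, upper
  limit plus one, would change during the induction.\<close>

lemma sum_mult_diff:
  "6 * (\<Sum>j = 1..<n. real j * (a - real j)) = (real n - 1) * real n * (3 * a - 2 * real n + 1)"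
proof (induction n)
  case 0
  then show ?case by simp
next
  case (Suc n)
  then show ?case
    \<comment> \<open>The split isolates \<open>n = 0\<close>, where the range stays empty and no
      term is added.\<close>
    by (cases n) (auto simp: algebra_simps)
qed

text \<open>The total is the binomial coefficient \<open>w + 2\<close> over 3; truncated subtraction
  is exact here because \<open>j < w\<close>.\<close>

lemma colour_sum:
  "real (w + (\<Sum>j = 1..<w. j * (w + 1 - j))) = real w * (real w + 1) * (real w + 2) / 6"
proof -
  have "real (\<Sum>j = 1..<w. j * (w + 1 - j)) = (\<Sum>j = 1..<w. real j * (real w + 1 - real j))"
    unfolding of_nat_sum by (rule sum.cong) (auto simp: of_nat_diff)
  then show ?thesis
    using sum_mult_diff[of "real w + 1" w] by (simp add: algebra_simps)
qed

section \<open>From the adjacency relation back to digraphs\<close>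

theorem theorem2:
  fixes G :: "('a, 'b) pre_digraph"
  assumes "graph G"
    and "induced_free (with_proj (disjoint_union (path_graph 4) (path_graph 2))) G"
  shows "real (chromatic_number G) \<le>
    real (clique_number G) * (real (clique_number G) + 1) * (real (clique_number G) + 2) / 6"
proof -
  interpret graph G by fact
  define w where "w = clique_number G"
  define E where "E u v \<longleftrightarrow> u \<rightarrow>\<^bsub>G\<^esub> v" for u v
  have sym: "E v u" if "E u v" for u v
    using that sym_arcs unfolding E_def by (simp add: symmetric_def sym_def)
  have irrefl: "\<not> E u u" for u
    unfolding E_def using adj_not_same by blast
  have clique: "clique G S \<longleftrightarrow> S \<subseteq> verts G \<and> pairwise E S" for S
    by (simp add: clique_def pairwise_def E_def)
  obtain K where K: "clique G K" "card K = w"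
    using clique_number_attained(1)[OF assms(1)] unfolding w_def by blast
  have bound: "card S \<le> w" if "S \<subseteq> verts G" "pairwise E S" for S
    using clique_number_attained(2)[OF assms(1)] that clique unfolding w_def by blast
  have free: "E a c \<or> E a d \<or> E b d \<or> (\<exists>x\<in>{a, b, c, d}. E x p \<or> E x q)"
    if sub: "{a, b, c, d, p, q} \<subseteq> verts G" and e: "E a b" "E b c" "E c d" "E p q"
    for a b c d p q
  proof (rule ccontr)
    assume non: "\<not> ?thesis"
    let ?H = "disjoint_union (path_graph 4) (path_graph 2)"
    define f where "f = case_sum (\<lambda>i::nat. [a, b, c, d] ! i) (\<lambda>i::nat. [p, q] ! i)"
    have H: "pair_graph ?H"
      by (intro pair_graph_disjoint_union pair_graph_path_graph)
    have V: "pverts ?H = {Inl 0, Inl (Suc 0), Inl 2, Inl 3, Inr 0, Inr (Suc 0)}"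
      by (auto simp: disjoint_union_def path_graph_def)
    have f: "f (Inl 0) = a" "f (Inl (Suc 0)) = b" "f (Inl 2) = c" "f (Inl 3) = d"
      "f (Inr 0) = p" "f (Inr (Suc 0)) = q"
      by (simp_all add: f_def eval_nat_numeral)
    \<comment> \<open>A coincidence would create an excluded adjacency: \<open>a = c\<close> turns
      \<open>E c d\<close> into \<open>E a d\<close>, and \<open>p = x\<close> turns
      \<open>E p q\<close> into \<open>E x q\<close>.\<close>
    have "distinct [a, b, c, d, p, q]"
      using non e irrefl sym by auto
    then have "inj_on f (pverts ?H)"
      unfolding V by (simp add: f)
    moreover have "f ` pverts ?H \<subseteq> verts G"
      unfolding V using sub by (simp add: f)
    moreover have "(u, v) \<in> parcs ?H \<longleftrightarrow> f u \<rightarrow>\<^bsub>G\<^esub> f v" if "u \<in> pverts ?H" "v \<in> pverts ?H" for u v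
    proof -
      have LL: "(Inl i, Inl j) \<in> parcs ?H \<longleftrightarrow> i < 4 \<and> j < 4 \<and> (j = Suc i \<or> i = Suc j)" for i j
        by (auto simp: disjoint_union_def path_graph_def map_prod_def image_iff)
      have RR: "(Inr i, Inr j) \<in> parcs ?H \<longleftrightarrow> i < 2 \<and> j < 2 \<and> (j = Suc i \<or> i = Suc j)" for i j
        by (auto simp: disjoint_union_def path_graph_def map_prod_def image_iff)
      have LR: "(Inl i, Inr j) \<notin> parcs ?H" "(Inr j, Inl i) \<notin> parcs ?H" for i j
        by (auto simp: disjoint_union_def)
      have pos: "E a b \<and> E b a \<and> E b c \<and> E c b \<and> E c d \<and> E d c \<and> E p q \<and> E q p"
        using e sym by blast
      have neg: "\<not> E a c \<and> \<not> E c a \<and> \<not> E a d \<and> \<not> E d a \<and> \<not> E b d \<and> \<not> E d b"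
        using non sym by blast
      have anti: "\<forall>x\<in>{a, b, c, d}. \<forall>y\<in>{p, q}. \<not> E x y \<and> \<not> E y x"
        using non sym by blast
      \<comment> \<open>Of the 36 ordered pairs, \<open>pos\<close> settles the edges,
        \<open>neg\<close> the non-edges of the P4, \<open>anti\<close> the pairs across,
        \<open>irrefl\<close> the diagonal.\<close>
      from that show ?thesis
        unfolding V E_def[symmetric]
        by (elim insertE emptyE; use pos neg anti irrefl in \<open>simp add: LL RR LR f\<close>)
    qed
    ultimately have "\<not> induced_free (with_proj ?H) G"
      using not_induced_free_iff[OF assms(1) H] by blast
    then show False using assms(2) by blast
  qed
  have "colourable E (verts G) (w + (\<Sum>j = 1..<w. j * (w + 1 - j)))"
  proof (rule P4_P2_free_colourable[OF _ _ _ free])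
    show "K \<subseteq> verts G" "pairwise E K"
      using K(1) clique by auto
  qed (use sym irrefl K(2) bound in auto)
  then have "chromatic_number G \<le> w + (\<Sum>j = 1..<w. j * (w + 1 - j))"
    unfolding colourable_def E_def
    by (auto simp: proper_colouring_def intro: chromatic_number_le)
  then have "real (chromatic_number G) \<le> real (w + (\<Sum>j = 1..<w. j * (w + 1 - j)))"
    by (rule of_nat_mono)
  then show ?thesis
    unfolding colour_sum w_def .
qed

end
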